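(* For every $\varepsilon>0$ and all integers $n\ge 2$, $s\ge 1$ there exist a positive integer $m$ and a non-empty set $X\subseteq\{0,1,\dots,m-1\}^n$ such that (i) for all $i\in[n]$, $AvgDeg_i(X)\ge s(n-\varepsilon)$; (ii) there is no non-empty $Y\subseteq X$ such that $MinDeg_i(Y)\ge s+1$ for all $i\in[n]$.
   Context: For a finite set $A$, $X\subseteq A^n$ and $S=\{i_1<\dots<i_k\}\subseteq[n]$, let $X_S=\{(x_{i_1},\dots,x_{i_k}):(x_1,\dots,x_n)\in X\}$. For $i\in[n]$, $G_i(X)$ is the bipartite graph with left vertex set $A$, right vertex set $X_{[n]\setminus\{i\}}$, and an edge between $a\in A$ and $(x_1,\dots,x_{i-1},x_{i+1},\dots,x_n)$ iff $(x_1,\dots,x_{i-1},a,x_{i+1},\dots,x_n)\in X$. $MinDeg_i(X)$ is the minimum degree of a right vertex of $G_i(X)$, and $AvgDeg_i(X)=|X|/|X_{[n]\setminus\{i\}}|$. *)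

theory Defs
  imports Complex_Main "HOL-Library.FuncSet"
begin

text \<open>
  Tuples in \<open>A\<^sup>n\<close> are the extensional functions \<open>{1..n} \<rightarrow>\<^sub>E A\<close>. A tuple indexed by
  \<open>S = {i\<^sub>1 < \<dots> < i\<^sub>k}\<close> is an extensional function on \<open>S\<close>, so \<open>X\<^sub>S\<close> consists of restrictions,
  and inserting \<open>a\<close> at position \<open>i\<close> into a tuple \<open>y\<close> over \<open>{1..n} - {i}\<close> is \<open>y(i := a)\<close>.
\<close>

definition coord_proj :: "nat set \<Rightarrow> (nat \<Rightarrow> 'a) set \<Rightarrow> (nat \<Rightarrow> 'a) set" where
  "coord_proj S X = (\<lambda>x. restrict x S) ` X"

record ('l, 'r) bigraph =
  left_verts :: "'l set"
  right_verts :: "'r set"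
  bi_edges :: "('l \<times> 'r) set"

definition right_degree :: "('l, 'r) bigraph \<Rightarrow> 'r \<Rightarrow> nat" where
  "right_degree G v = card {u \<in> left_verts G. (u, v) \<in> bi_edges G}"

definition coord_graph ::
  "'a set \<Rightarrow> nat \<Rightarrow> nat \<Rightarrow> (nat \<Rightarrow> 'a) set \<Rightarrow> ('a, nat \<Rightarrow> 'a) bigraph" where
  "coord_graph A n i X =
    \<lparr> left_verts = A,
      right_verts = coord_proj ({1..n} - {i}) X,
      bi_edges = {(a, y). a \<in> A \<and> y \<in> coord_proj ({1..n} - {i}) X \<and> y(i := a) \<in> X} \<rparr>"

text \<open>Only meaningful for finite non-empty \<open>X\<close>, because of \<^const>\<open>Min\<close>.\<close>

definition MinDeg :: "'a set \<Rightarrow> nat \<Rightarrow> nat \<Rightarrow> (nat \<Rightarrow> 'a) set \<Rightarrow> nat" where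
  "MinDeg A n i X =
    Min (right_degree (coord_graph A n i X) ` right_verts (coord_graph A n i X))"

definition AvgDeg :: "nat \<Rightarrow> nat \<Rightarrow> (nat \<Rightarrow> 'a) set \<Rightarrow> real" where
  "AvgDeg n i X = real (card X) / real (card (coord_proj ({1..n} - {i}) X))"

end

theory Submission
  imports Defs
begin

text \<open>
  Let \<open>X\<close> consist of the lattice points of the positive orthant whose coordinate sum lies in
  \<open>(t, t + n s]\<close>. As \<open>t\<close> grows, almost every axis-parallel line meeting \<open>X\<close> meets it in exactly
  \<open>n s\<close> points. Cut the range of sums into \<open>n\<close> blocks of length \<open>s\<close> and assign direction \<open>i\<close> to
  the \<open>i\<close>-th block. A convex function of the sum, of slope \<open>2 i\<close> on block \<open>i\<close>, minus the linear
  functional \<open>2 \<Sum>\<^sub>k k x\<^sub>k\<close> strictly increases whenever a point of block \<open>i\<close> moves in direction \<open>i\<close>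
  into another block. Hence the line in direction \<open>i\<close> through a point of \<open>Y\<close> that maximizes this
  potential, where \<open>i\<close> is the block of that point, meets \<open>Y\<close> in at most \<open>s\<close> points.
\<close>

section \<open>Binomial coefficients\<close>

lemma binomial_add_mult_le:
  "(t + Suc d choose Suc d) + k * (t + d choose d) \<le> t + k + Suc d choose Suc d"
proof (induction k)
  case 0
  then show ?case by simp
next
  case (Suc k)
  have "t + d choose d \<le> t + k + Suc d choose d"
    by (rule binomial_right_mono) simp
  with Suc show ?case by simp
qed

lemma binomial_shift_ratio_tendsto_1:
  "(\<lambda>t. real (t + d choose d) / real (t + k + d choose d)) \<longlonglongrightarrow> 1"
proof (induction d)
  case 0
  then show ?case by simp
next
  case (Suc d)
  have absorb: "real (m + Suc d choose Suc d)
      = real (m + Suc d) / real (Suc d) * real (m + d choose d)" for m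
    using Suc_times_binomial[of d "m + d"] by (simp add: field_simps flip: of_nat_mult of_nat_Suc)
  have "(\<lambda>t. 1 - real k / real (t + (k + Suc d))) \<longlonglongrightarrow> 1 - 0"
    by (intro tendsto_diff tendsto_const LIMSEQ_ignore_initial_segment lim_const_over_n)
  moreover have "1 - real k / real (t + (k + Suc d)) = real (t + Suc d) / real (t + k + Suc d)" for t
    by (simp add: field_simps)
  ultimately have "(\<lambda>t. real (t + Suc d) / real (t + k + Suc d)) \<longlonglongrightarrow> 1"
    by simp
  from tendsto_mult[OF this Suc.IH] show ?case
    unfolding absorb by simp
qed

section \<open>Lattice points in simplices and slabs\<close>

definition lattice_simplex :: "'i set \<Rightarrow> nat \<Rightarrow> ('i \<Rightarrow> nat) set" where
  "lattice_simplex I T = {x \<in> extensional I. sum x I \<le> T}"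

definition lattice_slab :: "'i set \<Rightarrow> nat \<Rightarrow> nat \<Rightarrow> ('i \<Rightarrow> nat) set" where
  "lattice_slab I t k = {x \<in> extensional I. sum x I \<in> {t<..t + k}}"

lemma lattice_simplex_subset_PiE:
  assumes "finite I"
  shows "lattice_simplex I T \<subseteq> I \<rightarrow>\<^sub>E {..T}"
proof
  fix x assume x: "x \<in> lattice_simplex I T"
  have "x k \<le> T" if "k \<in> I" for k
    using member_le_sum[of k I x] that assms x by (simp add: lattice_simplex_def)
  with x show "x \<in> I \<rightarrow>\<^sub>E {..T}"
    by (auto simp: lattice_simplex_def PiE_def)
qed

lemma finite_lattice_simplex: "finite I \<Longrightarrow> finite (lattice_simplex I T)"
  by (rule finite_subset[OF lattice_simplex_subset_PiE]) (auto intro: finite_PiE)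

lemma lattice_slab_subset_simplex: "lattice_slab I t k \<subseteq> lattice_simplex I (t + k)"
  by (auto simp: lattice_slab_def lattice_simplex_def)

lemma lattice_slab_subset_PiE:
  assumes "finite I"
  shows "lattice_slab I t k \<subseteq> I \<rightarrow>\<^sub>E {0..<Suc (t + k)}"
  using lattice_slab_subset_simplex lattice_simplex_subset_PiE[OF assms]
  unfolding atLeast0LessThan lessThan_Suc_atMost by (rule subset_trans)

lemma finite_lattice_slab: "finite I \<Longrightarrow> finite (lattice_slab I t k)"
  using finite_subset[OF lattice_slab_subset_simplex finite_lattice_simplex] .

lemma card_lattice_simplex_insert:
  fixes I :: "'i set"
  assumes "finite I" and "i \<notin> I"
  shows "card (lattice_simplex (insert i I) T) = (\<Sum>a\<le>T. card (lattice_simplex I (T - a)))"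
proof -
  have sum_upd: "sum (y(i := a)) (insert i I) = a + sum y I" for y :: "'i \<Rightarrow> nat" and a
    using assms by (simp, intro sum.cong) auto
  have "bij_betw (\<lambda>(a, y). y(i := a)) (SIGMA a:{..T}. lattice_simplex I (T - a))
      (lattice_simplex (insert i I) T)"
  proof (rule bij_betw_byWitness[where f' = "\<lambda>x. (x i, restrict x I)"])
    show "\<forall>p\<in>SIGMA a:{..T}. lattice_simplex I (T - a).
        (\<lambda>x. (x i, restrict x I)) ((\<lambda>(a, y). y(i := a)) p) = p"
      using assms by (auto simp: lattice_simplex_def extensional_restrict)
    show "\<forall>x\<in>lattice_simplex (insert i I) T.
        (\<lambda>(a, y). y(i := a)) ((\<lambda>x. (x i, restrict x I)) x) = x"
      by (auto simp: lattice_simplex_def fun_eq_iff extensional_def)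
    show "(\<lambda>(a, y). y(i := a)) ` (SIGMA a:{..T}. lattice_simplex I (T - a))
        \<subseteq> lattice_simplex (insert i I) T"
      by (auto simp: lattice_simplex_def sum_upd extensional_def fun_upd_other
          simp del: sum.insert fun_upd_apply)
    show "(\<lambda>x. (x i, restrict x I)) ` lattice_simplex (insert i I) T
        \<subseteq> (SIGMA a:{..T}. lattice_simplex I (T - a))"
      using assms by (auto simp: lattice_simplex_def)
  qed
  then have "card (lattice_simplex (insert i I) T) = card (SIGMA a:{..T}. lattice_simplex I (T - a))"
    by (rule bij_betw_same_card[symmetric])
  also have "\<dots> = (\<Sum>a\<le>T. card (lattice_simplex I (T - a)))"
    using assms(1) by (intro card_SigmaI) (auto intro: finite_lattice_simplex)
  finally show ?thesis .
qed

lemma card_lattice_simplex: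
  fixes I :: "'i set"
  assumes "finite I"
  shows "card (lattice_simplex I T) = (T + card I) choose card I"
  using assms
proof (induction I arbitrary: T rule: finite_induct)
  case empty
  have "lattice_simplex ({} :: 'i set) T = {\<lambda>_. undefined}"
    by (auto simp: lattice_simplex_def)
  then show ?case by simp
next
  case (insert i I)
  have "card (lattice_simplex (insert i I) T) = (\<Sum>a\<le>T. (T - a + card I) choose card I)"
    using insert by (simp add: card_lattice_simplex_insert)
  also have "\<dots> = (\<Sum>j\<le>T. (card I + j) choose card I)"
    by (rule sum.reindex_bij_witness[of _ "\<lambda>j. T - j" "\<lambda>a. T - a"]) (auto simp: add.commute)
  also have "\<dots> = Suc (card I + T) choose Suc (card I)"
    using choose_rising_sum(1)[of "card I" T] by simp
  finally show ?case
    using insert by (simp add: add.commute)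
qed

lemma card_lattice_slab_ge:
  assumes "finite I" and "card I = Suc d"
  shows "k * (t + d choose d) \<le> card (lattice_slab I t k)"
proof -
  have "lattice_slab I t k = lattice_simplex I (t + k) - lattice_simplex I t"
    by (auto simp: lattice_slab_def lattice_simplex_def)
  moreover have "lattice_simplex I t \<subseteq> lattice_simplex I (t + k)"
    by (auto simp: lattice_simplex_def)
  ultimately have "card (lattice_slab I t k)
      = (t + k + Suc d choose Suc d) - (t + Suc d choose Suc d)"
    using assms by (simp add: card_Diff_subset finite_lattice_simplex card_lattice_simplex)
  with binomial_add_mult_le[of t d k] show ?thesis by linarith
qed

lemma lattice_slab_nonempty:
  assumes "finite I" and "I \<noteq> {}" and "k > 0"
  shows "lattice_slab I t k \<noteq> {}"
proof -
  obtain d where d: "card I = Suc d"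
    using assms(1,2) by (metis card_gt_0_iff gr0_implies_Suc)
  have "0 < k * (t + d choose d)"
    using assms(3) by (simp add: zero_less_binomial)
  also have "\<dots> \<le> card (lattice_slab I t k)"
    by (rule card_lattice_slab_ge[OF assms(1) d])
  finally show ?thesis by auto
qed

section \<open>Average degrees\<close>

lemma AvgDeg_ge_of_coord_proj_subset:
  assumes "finite X" and "finite P" and "coord_proj ({1..n} - {i}) X \<subseteq> P"
  shows "real (card X) / real (card P) \<le> AvgDeg n i X"
proof (cases "X = {}")
  case True
  then show ?thesis by (simp add: AvgDeg_def)
next
  case False
  with assms(1) have "0 < card (coord_proj ({1..n} - {i}) X)"
    by (simp add: coord_proj_def card_gt_0_iff)
  moreover have "card (coord_proj ({1..n} - {i}) X) \<le> card P"
    using assms by (intro card_mono)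
  ultimately show ?thesis
    unfolding AvgDeg_def by (intro divide_left_mono) auto
qed

lemma coord_proj_lattice_simplex_subset:
  assumes "finite I" and "S \<subseteq> I"
  shows "coord_proj S (lattice_simplex I T) \<subseteq> lattice_simplex S T"
proof -
  have "sum x S \<le> T" if "sum x I \<le> T" for x :: "nat \<Rightarrow> nat"
    using sum_mono2[OF assms, of x] that by simp
  then show ?thesis
    by (auto simp: coord_proj_def lattice_simplex_def)
qed

lemma AvgDeg_lattice_slab_ge:
  assumes "i \<in> {1..n}" and n: "n = Suc d"
  shows "real k * (real (t + d choose d) / real (t + k + d choose d))
    \<le> AvgDeg n i (lattice_slab {1..n} t k)"
proof -
  let ?S = "{1..n} - {i}"
  have card_P: "card (lattice_simplex ?S (t + k)) = t + k + d choose d"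
    using card_lattice_simplex[of ?S "t + k"] assms by simp
  have "coord_proj ?S (lattice_slab {1..n} t k) \<subseteq> coord_proj ?S (lattice_simplex {1..n} (t + k))"
    unfolding coord_proj_def by (intro image_mono lattice_slab_subset_simplex)
  also have "\<dots> \<subseteq> lattice_simplex ?S (t + k)"
    by (intro coord_proj_lattice_simplex_subset) auto
  finally have proj: "coord_proj ?S (lattice_slab {1..n} t k) \<subseteq> lattice_simplex ?S (t + k)" .
  have "real (k * (t + d choose d)) \<le> real (card (lattice_slab {1..n} t k))"
    unfolding of_nat_le_iff using n by (intro card_lattice_slab_ge) auto
  then have "real k * (real (t + d choose d) / real (t + k + d choose d))
      \<le> real (card (lattice_slab {1..n} t k)) / real (card (lattice_simplex ?S (t + k)))"
    unfolding card_P by (simp add: divide_right_mono)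
  also have "\<dots> \<le> AvgDeg n i (lattice_slab {1..n} t k)"
    by (intro AvgDeg_ge_of_coord_proj_subset finite_lattice_slab finite_lattice_simplex proj) auto
  finally show ?thesis .
qed

lemma eventually_AvgDeg_lattice_slab_ge:
  assumes "n \<ge> 1" and "c < real k"
  shows "\<forall>\<^sub>F t in sequentially. \<forall>i\<in>{1..n}. c \<le> AvgDeg n i (lattice_slab {1..n} t k)"
proof -
  obtain d where n: "n = Suc d" using assms(1) by (cases n) auto
  let ?ratio = "\<lambda>t. real (t + d choose d) / real (t + k + d choose d)"
  have "(\<lambda>t. real k * ?ratio t) \<longlonglongrightarrow> real k * 1"
    by (intro tendsto_mult tendsto_const binomial_shift_ratio_tendsto_1)
  moreover have "c < real k * 1" using assms(2) by simp
  ultimately have "\<forall>\<^sub>F t in sequentially. c < real k * ?ratio t"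
    by (rule order_tendstoD)
  then show ?thesis
  proof eventually_elim
    case (elim t)
    then show ?case
      using AvgDeg_lattice_slab_ge[OF _ n, of _ k t] by (blast intro: less_imp_le order_trans)
  qed
qed

section \<open>The potential\<close>

text \<open>
  Adding the values at both ends of each unit step, rather than at the left end only, makes the
  supporting-line inequality strict in both directions as soon as \<open>b\<close> changes.
\<close>

definition trapezoid_sum :: "(nat \<Rightarrow> nat) \<Rightarrow> nat \<Rightarrow> int" where
  "trapezoid_sum b u = (\<Sum>j<u. int (b j) + int (b (Suc j)))"

lemma trapezoid_sum_diff:
  assumes "u \<le> v"
  shows "trapezoid_sum b v - trapezoid_sum b u = (\<Sum>j\<in>{u..<v}. int (b j) + int (b (Suc j)))"
  using sum_diff_nat_ivl[of 0 u v "\<lambda>j. int (b j) + int (b (Suc j))"] assms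
  by (simp add: trapezoid_sum_def lessThan_atLeast0)

lemma trapezoid_sum_increment_bounds:
  assumes b: "mono b" and less: "b u < b v"
  shows "2 * int (b u) * (int v - int u) < trapezoid_sum b v - trapezoid_sum b u"
    and "trapezoid_sum b v - trapezoid_sum b u < 2 * int (b v) * (int v - int u)"
proof -
  have uv: "u < v" using less monoD[OF b, of v u] by (meson not_less)
  have bounds: "2 * int (b u) \<le> int (b j) + int (b (Suc j))"
      "int (b j) + int (b (Suc j)) \<le> 2 * int (b v)" if "j \<in> {u..<v}" for j
    using that monoD[OF b, of u j] monoD[OF b, of u "Suc j"]
      monoD[OF b, of j v] monoD[OF b, of "Suc j" v] by simp_all
  have "(\<Sum>j\<in>{u..<v}. 2 * int (b u)) < (\<Sum>j\<in>{u..<v}. int (b j) + int (b (Suc j)))"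
  proof (rule sum_strict_mono_ex1)
    show "\<forall>j\<in>{u..<v}. 2 * int (b u) \<le> int (b j) + int (b (Suc j))"
      using bounds(1) by blast
    have "b u \<le> b (v - 1)" using uv by (intro monoD[OF b]) simp
    then show "\<exists>j\<in>{u..<v}. 2 * int (b u) < int (b j) + int (b (Suc j))"
      using uv less by (intro bexI[of _ "v - 1"]) auto
  qed simp
  with uv show "2 * int (b u) * (int v - int u) < trapezoid_sum b v - trapezoid_sum b u"
    by (simp add: trapezoid_sum_diff of_nat_diff mult.commute)
  have "(\<Sum>j\<in>{u..<v}. int (b j) + int (b (Suc j))) < (\<Sum>j\<in>{u..<v}. 2 * int (b v))"
  proof (rule sum_strict_mono_ex1)
    show "\<forall>j\<in>{u..<v}. int (b j) + int (b (Suc j)) \<le> 2 * int (b v)"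
      using bounds(2) by blast
    show "\<exists>j\<in>{u..<v}. int (b j) + int (b (Suc j)) < 2 * int (b v)"
      using uv less monoD[OF b, of "Suc u" v] by (intro bexI[of _ u]) auto
  qed simp
  with uv show "trapezoid_sum b v - trapezoid_sum b u < 2 * int (b v) * (int v - int u)"
    by (simp add: trapezoid_sum_diff of_nat_diff mult.commute)
qed

lemma trapezoid_sum_gt_supporting_line:
  assumes "mono b" and "b u \<noteq> b v"
  shows "trapezoid_sum b u + 2 * int (b u) * (int v - int u) < trapezoid_sum b v"
proof (cases "b u < b v")
  case True
  then show ?thesis
    using trapezoid_sum_increment_bounds(1)[OF assms(1) True] by simp
next
  case False
  with assms(2) have "b v < b u" by simp
  from trapezoid_sum_increment_bounds(2)[OF assms(1) this] show ?thesis
    by (simp add: algebra_simps)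
qed

definition potential :: "(nat \<Rightarrow> nat) \<Rightarrow> nat set \<Rightarrow> (nat \<Rightarrow> nat) \<Rightarrow> int" where
  "potential b I x = trapezoid_sum b (sum x I) - 2 * (\<Sum>k\<in>I. int k * int (x k))"

lemma potential_less_fun_upd:
  assumes "mono b" and "b (sum x I) = i" and "b (sum (x(i := a)) I) \<noteq> i"
  shows "potential b I x < potential b I (x(i := a))"
proof -
  let ?x' = "x(i := a)"
  have "(\<Sum>k\<in>I. int k * int (?x' k)) - (\<Sum>k\<in>I. int k * int (x k))
      = (\<Sum>k\<in>I. int k * (int (?x' k) - int (x k)))"
    by (simp only: sum_subtractf right_diff_distrib)
  also have "\<dots> = (\<Sum>k\<in>I. int i * (int (?x' k) - int (x k)))"
    by (intro sum.cong) auto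
  also have "\<dots> = int i * (int (sum ?x' I) - int (sum x I))"
    by (simp only: sum_subtractf of_nat_sum sum_distrib_left[symmetric])
  finally have linear: "(\<Sum>k\<in>I. int k * int (?x' k)) - (\<Sum>k\<in>I. int k * int (x k))
      = int i * (int (sum ?x' I) - int (sum x I))" .
  have "trapezoid_sum b (sum x I) + 2 * int i * (int (sum ?x' I) - int (sum x I))
      < trapezoid_sum b (sum ?x' I)"
    using trapezoid_sum_gt_supporting_line[of b "sum x I" "sum ?x' I"] assms by simp
  with linear show ?thesis
    unfolding potential_def by (simp only: mult.assoc)
qed

lemma obtain_line_within_level:
  fixes b :: "nat \<Rightarrow> nat"
  assumes "finite Y" and "Y \<noteq> {}" and "mono b"
  obtains x where "x \<in> Y"
    and "\<And>a. x(b (sum x I) := a) \<in> Y \<Longrightarrow> b (sum (x(b (sum x I) := a)) I) = b (sum x I)"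
proof -
  obtain x where x: "x \<in> Y" and max: "\<And>y. y \<in> Y \<Longrightarrow> potential b I y \<le> potential b I x"
    using obtains_MAX[OF assms(1,2), of "potential b I"] assms(1)
    by (metis Max_ge finite_imageI imageI)
  show thesis
  proof
    show "x \<in> Y" by (rule x)
    fix a assume "x(b (sum x I) := a) \<in> Y"
    then show "b (sum (x(b (sum x I) := a)) I) = b (sum x I)"
      using potential_less_fun_upd[OF assms(3) refl] max by (meson not_less)
  qed
qed

section \<open>Minimum degrees\<close>

lemma restrict_fun_upd_extensional:
  assumes "x \<in> extensional I"
  shows "(restrict x (I - {i}))(i := a) = x(i := a)"
  using assms by (auto simp: fun_eq_iff extensional_def)

lemma MinDeg_le_card_line:
  assumes "finite Y" and "Y \<subseteq> extensional {1..n}" and "x \<in> Y"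
  shows "MinDeg A n i Y \<le> card {a \<in> A. x(i := a) \<in> Y}"
proof -
  let ?G = "coord_graph A n i Y" and ?y = "restrict x ({1..n} - {i})"
  have y: "?y \<in> coord_proj ({1..n} - {i}) Y"
    using assms(3) by (simp add: coord_proj_def)
  have "?y(i := a) = x(i := a)" for a
    using assms by (intro restrict_fun_upd_extensional) auto
  then have "right_degree ?G ?y = card {a \<in> A. x(i := a) \<in> Y}"
    using y by (auto simp: right_degree_def coord_graph_def intro: arg_cong[where f = card])
  moreover have "MinDeg A n i Y \<le> right_degree ?G ?y"
    unfolding MinDeg_def using y assms(1)
    by (intro Min_le) (auto simp: coord_graph_def coord_proj_def)
  ultimately show ?thesis by simp
qed

lemma card_le_card_line_sums:
  fixes x :: "'i \<Rightarrow> nat"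
  assumes "finite I" and "i \<in> I" and "finite L" and "\<And>a. a \<in> B \<Longrightarrow> sum (x(i := a)) I \<in> L"
  shows "card B \<le> card L"
proof (rule card_inj_on_le)
  show "inj_on (\<lambda>a. sum (x(i := a)) I) B"
    using assms(1,2) by (auto intro!: inj_onI simp: sum.remove)
  show "(\<lambda>a. sum (x(i := a)) I) ` B \<subseteq> L" using assms(4) by blast
qed (rule assms(3))

lemma MinDeg_le_of_small_levels:
  fixes b :: "nat \<Rightarrow> nat"
  assumes Y: "finite Y" "Y \<noteq> {}" "Y \<subseteq> extensional {1..n}" and b: "mono b"
    and dir: "\<And>x. x \<in> Y \<Longrightarrow> b (sum x {1..n}) \<in> {1..n}"
    and level: "\<And>i. card {u \<in> (\<lambda>x. sum x {1..n}) ` Y. b u = i} \<le> s"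
  shows "\<exists>i\<in>{1..n}. MinDeg A n i Y \<le> s"
proof -
  obtain x where x: "x \<in> Y" and line: "\<And>a. x(b (sum x {1..n}) := a) \<in> Y \<Longrightarrow>
      b (sum (x(b (sum x {1..n}) := a)) {1..n}) = b (sum x {1..n})"
    using obtain_line_within_level[OF Y(1,2) b] by metis
  define i where "i = b (sum x {1..n})"
  have i: "i \<in> {1..n}" unfolding i_def by (rule dir[OF x])
  have "MinDeg A n i Y \<le> card {a \<in> A. x(i := a) \<in> Y}"
    by (rule MinDeg_le_card_line[OF Y(1,3) x])
  also have "\<dots> \<le> card {u \<in> (\<lambda>x. sum x {1..n}) ` Y. b u = i}"
  proof (rule card_le_card_line_sums[of "{1..n}" i _ _ x])
    show "sum (x(i := a)) {1..n} \<in> {u \<in> (\<lambda>x. sum x {1..n}) ` Y. b u = i}"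
      if "a \<in> {a \<in> A. x(i := a) \<in> Y}" for a
      using that line[folded i_def] by blast
  qed (use i Y(1) in auto)
  also note level
  finally show ?thesis using i by blast
qed

lemma MinDeg_subset_lattice_slab_le:
  assumes "s \<ge> 1" and "Y \<noteq> {}" and Y: "Y \<subseteq> lattice_slab {1..n} t (n * s)"
  shows "\<exists>i\<in>{1..n}. MinDeg A n i Y \<le> s"
proof -
  define block where "block u = Suc ((u - Suc t) div s)" for u
  have sum_Y: "t < sum x {1..n}" "sum x {1..n} \<le> t + n * s" if "x \<in> Y" for x
    using Y that by (auto simp: lattice_slab_def)
  have block_bounds: "t + (block u - 1) * s < u" "u \<le> t + (block u - 1) * s + s" if "t < u" for u
    using that assms(1) div_times_less_eq_dividend[of "u - Suc t" s]
      dividend_less_div_times[of s "u - Suc t"]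
    unfolding block_def diff_Suc_1 by linarith+
  show ?thesis
  proof (rule MinDeg_le_of_small_levels[where b = block])
    show "finite Y" "Y \<subseteq> extensional {1..n}"
      using Y finite_subset[OF Y finite_lattice_slab] by (auto simp: lattice_slab_def)
    show "mono block"
      unfolding block_def by (intro monoI Suc_le_mono[THEN iffD2] div_le_mono diff_le_mono)
    show "block (sum x {1..n}) \<in> {1..n}" if "x \<in> Y" for x
      using sum_Y[OF that] assms(1) by (auto simp: block_def Suc_le_eq div_less_iff_less_mult)
    show "card {u \<in> (\<lambda>x. sum x {1..n}) ` Y. block u = i} \<le> s" for i
    proof -
      have "{u \<in> (\<lambda>x. sum x {1..n}) ` Y. block u = i} \<subseteq> {t + (i - 1) * s<..t + (i - 1) * s + s}"
        using block_bounds sum_Y(1) by auto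
      from card_mono[OF _ this] show ?thesis by simp
    qed
  qed (rule assms(2))
qed

theorem theorem3:
  fixes \<epsilon> :: real and n s :: nat
  assumes "\<epsilon> > 0" and "n \<ge> 2" and "s \<ge> 1"
  shows "\<exists>(m::nat) (X :: (nat \<Rightarrow> nat) set).
           m > 0 \<and> X \<noteq> {} \<and> X \<subseteq> ({1..n} \<rightarrow>\<^sub>E {0..<m}) \<and>
           (\<forall>i\<in>{1..n}. AvgDeg n i X \<ge> real s * (real n - \<epsilon>)) \<and>
           \<not> (\<exists>Y. Y \<noteq> {} \<and> Y \<subseteq> X \<and> (\<forall>i\<in>{1..n}. MinDeg {0..<m} n i Y \<ge> s + 1))"
proof -
  have "real s * (real n - \<epsilon>) < real (n * s)"
    using assms by (simp add: algebra_simps)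
  moreover have "n \<ge> 1" using assms(2) by simp
  ultimately obtain t where avg:
      "\<forall>i\<in>{1..n}. real s * (real n - \<epsilon>) \<le> AvgDeg n i (lattice_slab {1..n} t (n * s))"
    using eventually_happens'[OF sequentially_bot eventually_AvgDeg_lattice_slab_ge] by blast
  let ?X = "lattice_slab {1..n} t (n * s)" and ?m = "Suc (t + n * s)"
  have "?X \<noteq> {}"
    using assms by (intro lattice_slab_nonempty) auto
  moreover have "?X \<subseteq> {1..n} \<rightarrow>\<^sub>E {0..<?m}"
    by (intro lattice_slab_subset_PiE) simp
  moreover have "\<not> (\<exists>Y. Y \<noteq> {} \<and> Y \<subseteq> ?X \<and> (\<forall>i\<in>{1..n}. MinDeg {0..<?m} n i Y \<ge> s + 1))"
    using MinDeg_subset_lattice_slab_le[OF assms(3)] by (metis Suc_eq_plus1 not_less_eq_eq)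
  ultimately show ?thesis
    using avg by (intro exI[of _ ?m] exI[of _ ?X]) simp
qed

end
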